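(* Let $l\ge 2$ and let $\hat{\mathfrak g}$ be the affine Lie algebra of type $B_l^{(1)}$. For every positive integer $n$, the weight $\lambda_n=(n-l+\tfrac12)\Lambda_0$ is admissible and $$\hat\Pi^\vee_{\lambda_n}=\{(\delta-\epsilon_1)^\vee,\alpha_1^\vee,\alpha_2^\vee,\dots,\alpha_l^\vee\}.$$ Furthermore, $\langle\lambda_n+\rho,\alpha_i^\vee\rangle=1$ for $i=1,\dots,l$, and $\langle\lambda_n+\rho,(\delta-\epsilon_1)^\vee\rangle=2n$.
   Context: $\mathfrak g$ is the complex simple Lie algebra of type $B_l$ with Cartan subalgebra $\mathfrak h$, root system $\Delta=\{\pm\epsilon_i\}\cup\{\pm\epsilon_i\pm\epsilon_j: i<j\}$, positive roots $\epsilon_i$ $(1\le i\le l)$ and $\epsilon_i\pm\epsilon_j$ $(i<j)$, simple roots $\alpha_i=\epsilon_i-\epsilon_{i+1}$ $(i<l)$, $\alpha_l=\epsilon_l$, highest root $\theta=\epsilon_1+\epsilon_2$. The invariant form is normalized by $(\theta,\theta)=2$, so $(\epsilon_i,\epsilon_j)=\delta_{ij}$. The affine Lie algebra is $\hat{\mathfrak g}=\mathfrak g\otimes\mathbb C[t,t^{-1}]\oplus\mathbb Cc$, extended as usual by the derivation $d=t\frac{d}{dt}$, with Cartan subalgebra $\hat{\mathfrak h}=\mathfrak h\oplus\mathbb Cc\oplus\mathbb Cd$. Elements of $\mathfrak h^*$ are extended by $0$ on $c,d$; $\delta$ is given by $\delta(d)=1$, $\delta|_{\mathfrak h\oplus\mathbb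 Cc}=0$; $\Lambda_0$ by $\Lambda_0(c)=1$, $\Lambda_0|_{\mathfrak h\oplus\mathbb Cd}=0$. The simple roots are $\alpha_0=\delta-\theta,\alpha_1,\dots,\alpha_l$; the real roots are $\alpha+m\delta$ $(\alpha\in\Delta,m\in\mathbb Z)$, positive if $m>0$, or $m=0$ and $\alpha$ is positive; the coroot of $\alpha+m\delta$ is $\alpha^\vee+\frac{2m}{(\alpha,\alpha)}c$. The weight $\rho$ satisfies $\langle\rho,\alpha_i^\vee\rangle=1$ for $0\le i\le l$. Let $\hat\Delta^{\vee\mathrm{re}}$ (resp. $\hat\Delta^{\vee\mathrm{re}}_+$) be the set of coroots of real (resp. positive real) roots, and $\hat\Pi^\vee=\{\alpha_0^\vee,\dots,\alpha_l^\vee\}$. For $\lambda\in\hat{\mathfrak h}^*$ put $\hat\Delta^{\vee\mathrm{re}}_\lambda=\{\alpha\in\hat\Delta^{\vee\mathrm{re}}:\langle\lambda,\alpha\rangle\in\mathbb Z\}$, $\hat\Delta^{\vee\mathrm{re}}_{\lambda+}=\hat\Delta^{\vee\mathrm{re}}_\lambda\cap\hat\Delta^{\vee\mathrm{re}}_+$, and let $\hat\Pi^\vee_\lambda$ be the set of elements of $\hat\Delta^{\vee\mathrm{re}}_{\lambda+}$ that are not equal to a sum of several elements of $\hat\Delta^{\vee\mathrm{re}}_{\lambda+}$. With $\mathbb Z_+=\{0,1,2,\dots\}$, the weight $\lambda$ is admissible if $\langle\lambda+\rho,\alpha\rangle\notin-\mathbb Z_+$ for all $\alpha\in\hat\Delta^{\vee\mathrm{re}}_+$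 and $\mathbb Q\hat\Delta^{\vee\mathrm{re}}_\lambda=\mathbb Q\hat\Pi^\vee$. *)

theory Defs
  imports Complex_Main "HOL-Library.Function_Algebras" "HOL-Library.Product_Plus"
    "HOL-Library.Nonpos_Ints"
begin

text \<open>
  The triple \<open>(x, a, b)\<close> stands for the element
  \<open>x\<^sub>1 h\<^sub>1 + \<dots> + x\<^sub>l h\<^sub>l + a c + b d\<close> of the Cartan subalgebra of the affine
  Lie algebra, where \<open>h\<^sub>1, \<dots>, h\<^sub>l\<close> is the basis of the finite Cartan subalgebra dual to
  \<open>\<epsilon>\<^sub>1, \<dots>, \<epsilon>\<^sub>l\<close>. The rank \<open>l\<close> is a variable, so the condition
  that only the indices \<open>1, \<dots>, l\<close> occur is imposed by the carrier \<open>cartan l\<close>.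
  Weights are linear functionals, and the pairing of a weight with an element of the Cartan
  subalgebra is function application.
\<close>

type_synonym cartan_elt = "(nat \<Rightarrow> complex) \<times> complex \<times> complex"
type_synonym weight = "cartan_elt \<Rightarrow> complex"

definition cartan :: "nat \<Rightarrow> cartan_elt set" where
  "cartan l = {(x, a, b). \<forall>i. i \<notin> {1..l} \<longrightarrow> x i = 0}"

definition hscale :: "complex \<Rightarrow> cartan_elt \<Rightarrow> cartan_elt" where
  "hscale z = (\<lambda>(x, a, b). (\<lambda>i. z * x i, z * a, z * b))"

definition h_basis :: "nat \<Rightarrow> cartan_elt" where
  "h_basis i = (\<lambda>k. if k = i then 1 else 0, 0, 0)"

definition c_elt :: cartan_elt where
  "c_elt = (0, 1, 0)"

definition d_elt :: cartan_elt where
  "d_elt = (0, 0, 1)"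

definition cartan_dual :: "nat \<Rightarrow> weight set" where
  "cartan_dual l = {f. (\<forall>x\<in>cartan l. \<forall>y\<in>cartan l. f (x + y) = f x + f y) \<and>
                       (\<forall>z. \<forall>x\<in>cartan l. f (hscale z x) = z * f x)}"

definition wscale :: "complex \<Rightarrow> weight \<Rightarrow> weight" where
  "wscale z f = (\<lambda>x. z * f x)"

definition eps :: "nat \<Rightarrow> weight" where
  "eps i = (\<lambda>(x, a, b). x i)"

definition Lambda0 :: weight where
  "Lambda0 = (\<lambda>(x, a, b). a)"

definition delta :: weight where
  "delta = (\<lambda>(x, a, b). b)"

definition fin_roots :: "nat \<Rightarrow> weight set" where
  "fin_roots l =
     (\<Union>i\<in>{1..l}. {eps i, - eps i}) \<union>
     (\<Union>i\<in>{1..l}. \<Union>j\<in>{i<..l}.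
        {eps i + eps j, eps i - eps j, - eps i + eps j, - eps i - eps j})"

definition fin_pos_roots :: "nat \<Rightarrow> weight set" where
  "fin_pos_roots l =
     (\<Union>i\<in>{1..l}. {eps i}) \<union>
     (\<Union>i\<in>{1..l}. \<Union>j\<in>{i<..l}. {eps i + eps j, eps i - eps j})"

definition theta :: weight where
  "theta = eps 1 + eps 2"

definition simple_root :: "nat \<Rightarrow> nat \<Rightarrow> weight" where
  "simple_root l i =
     (if i = 0 then delta - theta else if i < l then eps i - eps (i + 1) else eps l)"

definition real_roots :: "nat \<Rightarrow> weight set" where
  "real_roots l = {\<alpha> + wscale (of_int m) delta | \<alpha> m. \<alpha> \<in> fin_roots l}"

definition pos_real_roots :: "nat \<Rightarrow> weight set" where
  "pos_real_roots l = {\<alpha> + wscale (of_int m) delta | \<alpha> m.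
     \<alpha> \<in> fin_roots l \<and> (m > 0 \<or> m = 0 \<and> \<alpha> \<in> fin_pos_roots l)}"

text \<open>
  The normalised form, \<open>(\<epsilon>\<^sub>i, \<epsilon>\<^sub>j) = \<delta>\<^sub>i\<^sub>j\<close>. Only the restriction
  of its arguments to the finite Cartan subalgebra enters, so for a real root
  \<open>\<beta> = \<alpha> + m \<delta>\<close> we have \<open>(\<beta>, \<beta>) = (\<alpha>, \<alpha>)\<close>.
\<close>

definition form :: "nat \<Rightarrow> weight \<Rightarrow> weight \<Rightarrow> complex" where
  "form l f g = (\<Sum>i = 1..l. f (h_basis i) * g (h_basis i))"

text \<open>
  For \<open>\<beta> = \<alpha> + m \<delta>\<close> the first summand is \<open>\<alpha>\<^sup>\<or>\<close>, the element of the finite Cartan subalgebra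
  on which every \<open>\<mu>\<close> in its dual takes the value \<open>2 (\<mu>, \<alpha>) / (\<alpha>, \<alpha>)\<close>; moreover
  \<open>m = \<beta>(d)\<close>, so the second summand is \<open>(2 m / (\<alpha>, \<alpha>)) c\<close>.
\<close>

definition coroot :: "nat \<Rightarrow> weight \<Rightarrow> cartan_elt" where
  "coroot l \<beta> = (\<Sum>i = 1..l. hscale (2 * \<beta> (h_basis i) / form l \<beta> \<beta>) (h_basis i))
     + hscale (2 * \<beta> d_elt / form l \<beta> \<beta>) c_elt"

definition real_coroots :: "nat \<Rightarrow> cartan_elt set" where
  "real_coroots l = coroot l ` real_roots l"

definition pos_real_coroots :: "nat \<Rightarrow> cartan_elt set" where
  "pos_real_coroots l = coroot l ` pos_real_roots l"

definition simple_coroots :: "nat \<Rightarrow> cartan_elt set" where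
  "simple_coroots l = (\<lambda>i. coroot l (simple_root l i)) ` {0..l}"

definition integral_coroots :: "nat \<Rightarrow> weight \<Rightarrow> cartan_elt set" where
  "integral_coroots l \<Lambda> = {\<gamma> \<in> real_coroots l. \<Lambda> \<gamma> \<in> \<int>}"

definition pos_integral_coroots :: "nat \<Rightarrow> weight \<Rightarrow> cartan_elt set" where
  "pos_integral_coroots l \<Lambda> = integral_coroots l \<Lambda> \<inter> pos_real_coroots l"

text \<open>``Several'' means at least two, repetitions allowed.\<close>

definition integral_simple_coroots :: "nat \<Rightarrow> weight \<Rightarrow> cartan_elt set" where
  "integral_simple_coroots l \<Lambda> = {\<gamma> \<in> pos_integral_coroots l \<Lambda>.
     \<not> (\<exists>xs. set xs \<subseteq> pos_integral_coroots l \<Lambda> \<and> length xs \<ge> 2 \<and> \<gamma> = sum_list xs)}"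

lemma vector_space_rat: "vector_space (\<lambda>q::rat. hscale (of_rat q))"
  by unfold_locales
     (auto simp: hscale_def fun_eq_iff algebra_simps of_rat_add of_rat_mult)

definition rat_span :: "cartan_elt set \<Rightarrow> cartan_elt set" where
  "rat_span = module.span (\<lambda>q::rat. hscale (of_rat q))"

text \<open>
  The defining conditions determine \<open>\<rho>\<close> only up to adding multiples of \<open>\<delta>\<close>; hence \<open>\<rho>\<close>
  is a parameter below.
\<close>

definition is_rho :: "nat \<Rightarrow> weight \<Rightarrow> bool" where
  "is_rho l \<rho> \<longleftrightarrow> \<rho> \<in> cartan_dual l \<and> (\<forall>i\<in>{0..l}. \<rho> (coroot l (simple_root l i)) = 1)"

definition admissible :: "nat \<Rightarrow> weight \<Rightarrow> weight \<Rightarrow> bool" where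
  "admissible l \<rho> \<Lambda> \<longleftrightarrow> \<Lambda> \<in> cartan_dual l \<and>
     (\<forall>\<gamma>\<in>pos_real_coroots l. (\<Lambda> + \<rho>) \<gamma> \<notin> \<int>\<^sub>\<le>\<^sub>0) \<and>
     rat_span (integral_coroots l \<Lambda>) = rat_span (simple_coroots l)"

definition lambda_n :: "nat \<Rightarrow> nat \<Rightarrow> weight" where
  "lambda_n l n = wscale (of_nat n - of_nat l + 1 / 2) Lambda0"

end

theory Submission
  imports Defs
begin

text \<open>
  Every real coroot has the shape \<open>s h\<^sub>i + t h\<^sub>j + a c\<close> with signs \<open>s, t = \<plusminus>1\<close> and
  \<open>1 \<le> i \<le> j \<le> l\<close>; the case \<open>i = j\<close>, which forces \<open>s = t\<close> and \<open>a\<close> even, gives the coroots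
  \<open>\<plusminus>2 h\<^sub>i + 2 m c\<close> of the short roots, and positivity means \<open>a > 0\<close>, or \<open>a = 0\<close> and
  \<open>s = 1\<close>. The weight \<open>\<lambda>\<^sub>n\<close> takes the value \<open>a (n - l + 1/2)\<close> on this element; as
  \<open>n - l + 1/2\<close> is half an odd integer, the integral coroots are those with \<open>a\<close> even.

  Two facts then determine the integral simple coroots. Every positive integral coroot is a sum of
  members of the claimed set \<open>S = {(\<delta> - \<epsilon>\<^sub>1)\<^sup>\<or>, \<alpha>\<^sub>1\<^sup>\<or>, \<dots>, \<alpha>\<^sub>l\<^sup>\<or>}\<close>
  (\<open>candidates\<close>; see \<open>pos_integral_sums\<close>): writing \<open>(\<delta> - \<epsilon>\<^sub>1)\<^sup>\<or> = -2 h\<^sub>1 + 2 c\<close>, we have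
  \[ s h_i + t h_j + 2 c = (\delta - \epsilon_1)^\vee + (h_1 + s h_i) + (h_1 + t h_j), \]
  where the last two summands are sums of finite simple coroots, and further multiples of \<open>2 c\<close>
  are the case \<open>h\<^sub>1 - h\<^sub>1 + 2 c\<close>. And there is a
  height, an additive function that is 1 on \<open>S\<close> and at least 1 on all positive integral
  coroots, so no member of \<open>S\<close> is a sum of two or more of them
  (\<open>indecomposables_eq_of_height\<close>).

  The height sends \<open>h\<^sub>i\<close> to \<open>l - i + 1/2\<close> and \<open>c\<close> to \<open>l\<close>. The weight \<open>\<lambda>\<^sub>n + \<rho>\<close> has the same
  values on the \<open>h\<^sub>i\<close>, and its value \<open>n + l - 1/2\<close> on \<open>c\<close> is at least \<open>l\<close>, so one estimate
  (\<open>height_ge_1\<close>) shows that both functions are at least 1 on positive coroots with even \<open>a\<close>. If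
  \<open>a\<close> is odd, \<open>\<lambda>\<^sub>n + \<rho>\<close> takes a value in \<open>1/2 + \<int>\<close>. This gives the first
  condition of admissibility. The second one holds because \<open>S\<close> already spans all
  \<open>h\<^sub>i\<close> and \<open>c\<close> over the rationals.
\<close>

section \<open>The shape of the coroots\<close>

definition signed_pair :: "int \<Rightarrow> nat \<Rightarrow> int \<Rightarrow> nat \<Rightarrow> int \<Rightarrow> cartan_elt" where
  "signed_pair s i t j a =
     hscale (of_int s) (h_basis i) + hscale (of_int t) (h_basis j) + hscale (of_int a) c_elt"

lemma signed_pair_eq:
  "signed_pair s i t j a =
     (\<lambda>k. (if k = i then of_int s else 0) + (if k = j then of_int t else 0), of_int a, 0)"
  by (auto simp: signed_pair_def hscale_def h_basis_def c_elt_def fun_eq_iff)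

lemma coroot_eq:
  "coroot l \<beta> =
     (\<lambda>k. if k \<in> {1..l} then 2 * \<beta> (h_basis k) / form l \<beta> \<beta> else 0,
      2 * \<beta> d_elt / form l \<beta> \<beta>, 0)"
proof -
  have sum_eq: "(\<Sum>i\<in>A. hscale (g i) (h_basis i)) = (\<lambda>k. if k \<in> A then g k else 0, 0, 0)"
    if "finite A" for A :: "nat set" and g
    using that
    by induction (auto simp: hscale_def h_basis_def fun_eq_iff zero_prod_def)
  show ?thesis
    unfolding coroot_def by (subst sum_eq) (auto simp: hscale_def c_elt_def fun_eq_iff)
qed

lemma coroot_short:
  assumes "i \<in> {1..l}" "s \<in> {1, -1}"
    and \<beta>: "\<And>k. \<beta> (h_basis k) = (if k = i then of_int s else 0)" "\<beta> d_elt = of_int m"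
  shows "coroot l \<beta> = signed_pair s i s i (2 * m)"
proof -
  have "form l \<beta> \<beta> = (\<Sum>k = 1..l. if k = i then 1 else 0)"
    unfolding form_def using assms(2) by (intro sum.cong) (auto simp: \<beta>)
  then have "form l \<beta> \<beta> = 1"
    using assms(1) by simp
  then show ?thesis
    using assms(1) by (auto simp: coroot_eq signed_pair_eq \<beta> fun_eq_iff)
qed

lemma coroot_long:
  assumes "i \<in> {1..l}" "j \<in> {1..l}" "i \<noteq> j" "s \<in> {1, -1}" "t \<in> {1, -1}"
    and \<beta>: "\<And>k. \<beta> (h_basis k) = (if k = i then of_int s else 0) + (if k = j then of_int t else 0)"
      "\<beta> d_elt = of_int m"
  shows "coroot l \<beta> = signed_pair s i t j m"
proof -
  have "form l \<beta> \<beta> = (\<Sum>k = 1..l. (if k = i then 1 else 0) + (if k = j then 1 else 0))"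
    unfolding form_def using assms(3-5) by (intro sum.cong) (auto simp: \<beta>)
  then have "form l \<beta> \<beta> = 2"
    using assms(1,2) by (simp add: sum.distrib)
  then show ?thesis
    using assms(1-3) by (auto simp: coroot_eq signed_pair_eq \<beta> fun_eq_iff)
qed

lemmas root_eval = eps_def h_basis_def d_elt_def delta_def wscale_def

text \<open>
  Short roots are the case \<open>i = j\<close>; they have squared length 1 instead of 2, which doubles the
  coefficient of \<open>c\<close>.
\<close>

lemma coroot_fin_pos_root:
  assumes "\<alpha> \<in> fin_pos_roots l"
  obtains i t j where "1 \<le> i" "i \<le> j" "j \<le> l" "t \<in> {1, -1}" "i = j \<longrightarrow> t = 1"
    "\<forall>m. coroot l (\<alpha> + wscale (of_int m) delta) =
       signed_pair 1 i t j (if i = j then 2 * m else m)"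
proof -
  from assms consider (short) i where "i \<in> {1..l}" "\<alpha> = eps i"
    | (plus) i j where "i \<in> {1..l}" "j \<in> {i<..l}" "\<alpha> = eps i + eps j"
    | (minus) i j where "i \<in> {1..l}" "j \<in> {i<..l}" "\<alpha> = eps i - eps j"
    by (auto simp: fin_pos_roots_def)
  then show thesis
  proof cases
    case short
    then have "coroot l (\<alpha> + wscale (of_int m) delta) = signed_pair 1 i 1 i (2 * m)" for m
      by (intro coroot_short) (auto simp: root_eval)
    then show thesis
      using short by (intro that[of i i 1]) auto
  next
    case plus
    then have "coroot l (\<alpha> + wscale (of_int m) delta) = signed_pair 1 i 1 j m" for m
      by (intro coroot_long) (auto simp: root_eval)
    then show thesis
      using plus by (intro that[of i j 1]) auto
  next
    case minus
    then have "coroot l (\<alpha> + wscale (of_int m) delta) = signed_pair 1 i (-1) j m" for m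
      by (intro coroot_long) (auto simp: root_eval)
    then show thesis
      using minus by (intro that[of i j "-1"]) auto
  qed
qed

lemma fin_root_cases:
  assumes "\<alpha> \<in> fin_roots l"
  shows "\<alpha> \<in> fin_pos_roots l \<or> - \<alpha> \<in> fin_pos_roots l"
  using assms by (fastforce simp: fin_roots_def fin_pos_roots_def)

lemma coroot_uminus: "coroot l (- \<beta>) = - coroot l \<beta>"
  by (auto simp: coroot_eq form_def fun_eq_iff)

lemma signed_pair_uminus: "- signed_pair s i t j a = signed_pair (- s) i (- t) j (- a)"
  by (auto simp: signed_pair_eq fun_eq_iff)

lemma coroot_fin_root:
  assumes "\<alpha> \<in> fin_roots l"
  obtains s i t j where "1 \<le> i" "i \<le> j" "j \<le> l" "s \<in> {1, -1}" "t \<in> {1, -1}" "i = j \<longrightarrow> s = t"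
    "\<forall>m. coroot l (\<alpha> + wscale (of_int m) delta) =
       signed_pair s i t j (if i = j then 2 * m else m)"
proof (cases "\<alpha> \<in> fin_pos_roots l")
  case True
  then show thesis
    by (rule coroot_fin_pos_root) (metis that insertI1)
next
  case False
  then have "- \<alpha> \<in> fin_pos_roots l"
    using fin_root_cases[OF assms] by blast
  then obtain i t j where ij: "1 \<le> i" "i \<le> j" "j \<le> l" "t \<in> {1, -1}" "i = j \<longrightarrow> t = 1"
    and neg: "\<forall>m. coroot l (- \<alpha> + wscale (of_int m) delta) =
       signed_pair 1 i t j (if i = j then 2 * m else m)"
    by (rule coroot_fin_pos_root)
  have "coroot l (\<alpha> + wscale (of_int m) delta) =
      signed_pair (-1) i (- t) j (if i = j then 2 * m else m)" for m
  proof -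
    have "\<alpha> + wscale (of_int m) delta = - (- \<alpha> + wscale (of_int (- m)) delta)"
      by (simp add: wscale_def fun_eq_iff)
    then have "coroot l (\<alpha> + wscale (of_int m) delta) =
        - coroot l (- \<alpha> + wscale (of_int (- m)) delta)"
      by (simp only: coroot_uminus)
    also have "\<dots> = - signed_pair 1 i t j (if i = j then 2 * (- m) else - m)"
      by (simp only: neg)
    finally show ?thesis
      by (simp add: signed_pair_uminus)
  qed
  then show thesis
    using ij by (intro that[of i j "-1" "- t"]) auto
qed

text \<open>
  The integer \<open>a\<close> is twice the multiple of \<open>\<delta>\<close> for a short root, hence the parity condition for
  \<open>i = j\<close>.
\<close>

lemma pos_real_coroot_cases:
  assumes "\<gamma> \<in> pos_real_coroots l"
  obtains s i t j a where "\<gamma> = signed_pair s i t j a" "1 \<le> i" "i \<le> j" "j \<le> l"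
    "s \<in> {1, -1}" "t \<in> {1, -1}" "i = j \<longrightarrow> s = t \<and> even a" "a > 0 \<or> a = 0 \<and> s = 1"
proof -
  from assms obtain \<alpha> m where \<gamma>: "\<gamma> = coroot l (\<alpha> + wscale (of_int m) delta)"
    and \<alpha>: "\<alpha> \<in> fin_roots l" and m: "m > 0 \<or> m = 0 \<and> \<alpha> \<in> fin_pos_roots l"
    by (auto simp: pos_real_coroots_def pos_real_roots_def)
  show thesis
  proof (cases "m > 0")
    case True
    from \<alpha> obtain s i t j where
      "1 \<le> i" "i \<le> j" "j \<le> l" "s \<in> {1, -1}" "t \<in> {1, -1}" "i = j \<longrightarrow> s = t"
      "\<forall>m. coroot l (\<alpha> + wscale (of_int m) delta) =
         signed_pair s i t j (if i = j then 2 * m else m)"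
      by (rule coroot_fin_root)
    then show thesis
      using True \<gamma> by (intro that[of s i t j "if i = j then 2 * m else m"]) auto
  next
    case False
    with m have "m = 0" "\<alpha> \<in> fin_pos_roots l"
      by auto
    from this(2) obtain i t j where
      ij: "1 \<le> i" "i \<le> j" "j \<le> l" "t \<in> {1, -1}" "i = j \<longrightarrow> t = 1" and
      eq: "\<forall>m. coroot l (\<alpha> + wscale (of_int m) delta) =
         signed_pair 1 i t j (if i = j then 2 * m else m)"
      by (rule coroot_fin_pos_root)
    have "\<gamma> = signed_pair 1 i t j 0"
      using \<gamma> \<open>m = 0\<close> eq[rule_format, of 0] by simp
    then show thesis
      using ij by (intro that[of 1 i t j 0]) auto
  qed
qed

lemma coroot_simple_root:
  assumes "i \<in> {1..l}"
  shows "coroot l (simple_root l i) =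
    (if i < l then signed_pair 1 i (-1) (i + 1) 0 else signed_pair 1 l 1 l 0)"
proof (cases "i < l")
  case True
  then have "coroot l (eps i - eps (i + 1)) = signed_pair 1 i (-1) (i + 1) 0"
    using assms by (intro coroot_long) (auto simp: root_eval)
  then show ?thesis
    using True assms by (simp add: simple_root_def)
next
  case False
  have "coroot l (eps l) = signed_pair 1 l 1 l (2 * 0)"
    using assms by (intro coroot_short) (auto simp: root_eval)
  then show ?thesis
    using False assms by (simp add: simple_root_def)
qed

lemma coroot_simple_root_0:
  assumes "l \<ge> 2"
  shows "coroot l (simple_root l 0) = signed_pair (-1) 1 (-1) 2 1"
  using assms unfolding simple_root_def theta_def
  by (auto intro!: coroot_long simp: root_eval)

lemma coroot_delta_minus_eps_1:
  assumes "l \<ge> 1"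
  shows "coroot l (delta - eps 1) = signed_pair (-1) 1 (-1) 1 2"
proof -
  have "coroot l (delta - eps 1) = signed_pair (-1) 1 (-1) 1 (2 * 1)"
    using assms by (intro coroot_short) (auto simp: root_eval)
  then show ?thesis
    by simp
qed

section \<open>Sums of simple coroots, and a height\<close>

definition list_sums :: "'a::comm_monoid_add set \<Rightarrow> 'a set" where
  "list_sums S = {sum_list xs | xs. set xs \<subseteq> S}"

lemma list_sums_zero: "0 \<in> list_sums S"
  unfolding list_sums_def by (auto intro!: exI[of _ "[]"])

lemma list_sums_base: "x \<in> S \<Longrightarrow> x \<in> list_sums S"
  unfolding list_sums_def by (auto intro!: exI[of _ "[x]"])

lemma list_sums_add:
  assumes "x \<in> list_sums S" "y \<in> list_sums S"
  shows "x + y \<in> list_sums S"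
proof -
  obtain xs ys where "set xs \<subseteq> S" "x = sum_list xs" "set ys \<subseteq> S" "y = sum_list ys"
    using assms unfolding list_sums_def by auto
  then show ?thesis
    unfolding list_sums_def by (auto intro!: exI[of _ "xs @ ys"])
qed

text \<open>
  A sum of at least two members of \<open>P\<close> has height at least 2, so members of \<open>S\<close> are indecomposable.
  Conversely, an indecomposable member of \<open>P\<close> is a sum over a list from \<open>S\<close> of length at most
  1, and the list is not empty because 0 has height 0.
\<close>

lemma indecomposables_eq_of_height:
  fixes height :: "'a::comm_monoid_add \<Rightarrow> real"
  assumes "S \<subseteq> P" and gen: "P \<subseteq> list_sums S"
    and zero: "height 0 = 0" and add: "\<And>x y. height (x + y) = height x + height y"
    and ge_1: "\<And>x. x \<in> P \<Longrightarrow> height x \<ge> 1"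
    and eq_1: "\<And>x. x \<in> S \<Longrightarrow> height x = 1"
  shows "{x \<in> P. \<not> (\<exists>xs. set xs \<subseteq> P \<and> length xs \<ge> 2 \<and> x = sum_list xs)} = S"
proof (intro equalityI subsetI)
  fix x assume "x \<in> S"
  have "height (sum_list xs) \<ge> real (length xs)" if "set xs \<subseteq> P" for xs
    using that by (induction xs) (auto simp: zero add dest: ge_1)
  then have "height (sum_list xs) \<ge> 2" if "set xs \<subseteq> P" "length xs \<ge> 2" for xs
    using that by force
  then show "x \<in> {x \<in> P. \<not> (\<exists>xs. set xs \<subseteq> P \<and> length xs \<ge> 2 \<and> x = sum_list xs)}"
    using eq_1[OF \<open>x \<in> S\<close>] \<open>x \<in> S\<close> \<open>S \<subseteq> P\<close> by fastforce
next
  fix x assume x: "x \<in> {x \<in> P. \<not> (\<exists>xs. set xs \<subseteq> P \<and> length xs \<ge> 2 \<and> x = sum_list xs)}"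
  with gen obtain xs where xs: "set xs \<subseteq> S" "x = sum_list xs"
    unfolding list_sums_def by blast
  with x \<open>S \<subseteq> P\<close> have "length xs < 2"
    using leI by blast
  moreover have "xs \<noteq> []"
    using x xs zero ge_1[of x] by auto
  ultimately obtain y where "xs = [y]"
    by (cases xs) auto
  with xs show "x \<in> S"
    by simp
qed

definition candidates :: "nat \<Rightarrow> cartan_elt set" where
  "candidates l =
     insert (coroot l (delta - eps 1)) ((\<lambda>i. coroot l (simple_root l i)) ` {1..l})"

lemma difference_sums:
  assumes "1 \<le> i" "i \<le> j" "j \<le> l"
  shows "signed_pair 1 i (-1) j 0 \<in> list_sums (candidates l)"
  using assms(2,3)
proof (induction j rule: dec_induct)
  case base
  have "signed_pair 1 i (-1) i 0 = 0"
    by (auto simp: signed_pair_eq fun_eq_iff zero_prod_def)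
  then show ?case
    by (simp add: list_sums_zero)
next
  case (step j)
  then have "coroot l (simple_root l j) = signed_pair 1 j (-1) (j + 1) 0"
    using assms(1) by (simp add: coroot_simple_root)
  moreover have "coroot l (simple_root l j) \<in> candidates l"
    using step assms(1) by (auto simp: candidates_def)
  ultimately have "signed_pair 1 j (-1) (Suc j) 0 \<in> list_sums (candidates l)"
    by (simp add: list_sums_base)
  moreover have "signed_pair 1 i (-1) (Suc j) 0 =
      signed_pair 1 i (-1) j 0 + signed_pair 1 j (-1) (Suc j) 0"
    by (auto simp: signed_pair_eq fun_eq_iff)
  ultimately show ?case
    using step by (auto intro: list_sums_add)
qed

lemma sum_sums:
  assumes "i \<in> {1..l}" "j \<in> {1..l}"
  shows "signed_pair 1 i 1 j 0 \<in> list_sums (candidates l)"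
proof -
  have "coroot l (simple_root l l) \<in> candidates l"
    using assms by (auto simp: candidates_def)
  then have "signed_pair 1 l 1 l 0 \<in> list_sums (candidates l)"
    using assms coroot_simple_root[of l l] by (simp add: list_sums_base)
  moreover have "signed_pair 1 i 1 j 0 =
      signed_pair 1 i (-1) l 0 + signed_pair 1 j (-1) l 0 + signed_pair 1 l 1 l 0"
    by (auto simp: signed_pair_eq fun_eq_iff)
  ultimately show ?thesis
    using assms by (auto intro!: list_sums_add difference_sums)
qed

text \<open>
  Since \<open>(\<delta> - \<epsilon>\<^sub>1)\<^sup>\<or> = 2 c - 2 h\<^sub>1\<close>, two copies of \<open>h\<^sub>1\<close> are available to be paired with the
  two signed basis vectors, and \<open>h\<^sub>1 \<plusminus> h\<^sub>i\<close> is a sum of finite simple coroots whichever the sign is.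
  The induction adds \<open>2 c\<close>, itself of this form as \<open>h\<^sub>1 - h\<^sub>1 + 2 c\<close>.
\<close>

lemma affine_sums:
  assumes "i \<in> {1..l}" "j \<in> {1..l}" "s \<in> {1, -1}" "t \<in> {1, -1}"
  shows "signed_pair s i t j (2 * int (Suc m)) \<in> list_sums (candidates l)"
proof -
  have two: "signed_pair s i t j 2 \<in> list_sums (candidates l)"
    if "i \<in> {1..l}" "j \<in> {1..l}" "s \<in> {1, -1}" "t \<in> {1, -1}" for s i t j
  proof -
    have "signed_pair 1 1 s i 0 \<in> list_sums (candidates l)"
      if "i \<in> {1..l}" "s \<in> {1, -1}" for s i
      using that sum_sums[of 1 l i] difference_sums[of 1 i l] by auto
    moreover have "signed_pair (-1) 1 (-1) 1 2 \<in> list_sums (candidates l)"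
      using that coroot_delta_minus_eps_1[of l]
      by (intro list_sums_base) (auto simp: candidates_def)
    moreover have "signed_pair s i t j 2 =
        signed_pair (-1) 1 (-1) 1 2 + signed_pair 1 1 s i 0 + signed_pair 1 1 t j 0"
      by (auto simp: signed_pair_eq fun_eq_iff)
    ultimately show ?thesis
      using that by (auto intro!: list_sums_add)
  qed
  show ?thesis
  proof (induction m)
    case 0
    then show ?case
      using two[OF assms] by simp
  next
    case (Suc m)
    have "signed_pair s i t j (2 * int (Suc (Suc m))) =
        signed_pair s i t j (2 * int (Suc m)) + signed_pair 1 1 (-1) 1 2"
      by (auto simp: signed_pair_eq fun_eq_iff)
    moreover have "signed_pair 1 1 (-1) 1 2 \<in> list_sums (candidates l)"
      using assms by (intro two) auto
    ultimately show ?case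
      using Suc by (auto intro: list_sums_add)
  qed
qed

text \<open>
  The coefficients are the only ones for which all members of \<open>candidates l\<close> get height 1: solve
  downwards from \<open>2 h\<^sub>l\<close> for the \<open>h\<^sub>i\<close>, then \<open>2 c - 2 h\<^sub>1\<close> for \<open>c\<close>. Real values make heights comparable.
\<close>

definition height :: "nat \<Rightarrow> cartan_elt \<Rightarrow> real" where
  "height l = (\<lambda>(x, a, b). (\<Sum>i = 1..l. (real l - real i + 1 / 2) * Re (x i)) + real l * Re a)"

lemma height_zero: "height l 0 = 0"
  by (simp add: height_def zero_prod_def)

lemma height_add: "height l (x + y) = height l x + height l y"
  by (cases x; cases y) (simp add: height_def distrib_left sum.distrib)

lemma height_signed_pair:
  assumes "i \<in> {1..l}" "j \<in> {1..l}"
  shows "height l (signed_pair s i t j a) =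
    of_int s * (real l - real i + 1 / 2) + of_int t * (real l - real j + 1 / 2) + of_int a * real l"
proof -
  have "(\<Sum>k = 1..l. (real l - real k + 1 / 2) *
          Re ((if k = i then of_int s else 0) + (if k = j then of_int t else 0))) =
      (\<Sum>k = 1..l. (if k = i then of_int s * (real l - real i + 1 / 2) else 0) +
          (if k = j then of_int t * (real l - real j + 1 / 2) else 0))"
    by (intro sum.cong) (auto simp: algebra_simps)
  also have "\<dots> = of_int s * (real l - real i + 1 / 2) + of_int t * (real l - real j + 1 / 2)"
    using assms by (simp add: sum.distrib)
  finally show ?thesis
    by (simp add: height_def signed_pair_eq)
qed

lemma height_candidates:
  assumes "l \<ge> 1" "\<gamma> \<in> candidates l"
  shows "height l \<gamma> = 1"
  using assms
  by (auto simp: candidates_def coroot_simple_root coroot_delta_minus_eps_1 height_signed_pair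
      simp del: One_nat_def)

text \<open>
  The bound on \<open>K\<close> makes \<open>a K \<ge> 2 l\<close> for \<open>a \<ge> 2\<close>, and \<open>2 l\<close> exceeds by 1 the largest
  amount \<open>2 (l - 1/2)\<close> that the other two terms can subtract. It is stated for general \<open>K\<close> because
  it serves both the height, where \<open>K = l\<close>, and \<open>\<lambda>\<^sub>n + \<rho>\<close>, where \<open>K = n + l - 1/2\<close>.
\<close>

lemma height_ge_1:
  fixes K :: real
  assumes "1 \<le> i" "i \<le> j" "j \<le> l" "s \<in> {1, -1}" "t \<in> {1, -1}" "i = j \<longrightarrow> s = t"
    and "a > 0 \<or> a = 0 \<and> s = 1" "even a" "K \<ge> real l"
  shows "of_int s * (real l - real i + 1 / 2) + of_int t * (real l - real j + 1 / 2)
    + of_int a * K \<ge> 1"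
proof (cases "a = 0")
  case True
  have "real i + 1 \<le> real j" if "t = -1"
    using that True assms by (cases "i = j") auto
  then show ?thesis
    using True assms by auto
next
  case False
  with assms have "a \<ge> 2"
    by (auto elim!: evenE)
  then have "of_int a * K \<ge> 2 * K"
    using assms(9) by (intro mult_right_mono) auto
  moreover have "of_int s * (real l - real i + 1 / 2) \<ge> - (real l - 1 / 2)"
    using assms(1-4) by auto
  moreover have "of_int t * (real l - real j + 1 / 2) \<ge> - (real l - 1 / 2)"
    using assms(1-3,5) by auto
  ultimately show ?thesis
    using assms(9) by linarith
qed

section \<open>The integral coroots of the weight\<close>

lemma lambda_n_signed_pair:
  "lambda_n l n (signed_pair s i t j a) = of_int a * (of_nat n - of_nat l + 1 / 2)"
  by (simp add: lambda_n_def wscale_def Lambda0_def signed_pair_eq)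

lemma odd_half_notin_Ints:
  assumes "odd k"
  shows "(of_int k / 2 :: complex) \<notin> \<int>"
proof
  assume "(of_int k / 2 :: complex) \<in> \<int>"
  then obtain m where "(of_int k / 2 :: complex) = of_int m"
    by (auto elim: Ints_cases)
  then have "(of_int k :: complex) = of_int (2 * m)"
    by (simp add: field_simps)
  with assms show False
    by (simp only: of_int_eq_iff) simp
qed

lemma lambda_n_integral_iff:
  "lambda_n l n (signed_pair s i t j a) \<in> \<int> \<longleftrightarrow> even a"
proof -
  have eq: "lambda_n l n (signed_pair s i t j a) =
      of_int (a * (2 * int n - 2 * int l + 1)) / 2"
    by (simp add: lambda_n_signed_pair field_simps)
  show ?thesis
  proof
    assume "lambda_n l n (signed_pair s i t j a) \<in> \<int>"
    then have "even (a * (2 * int n - 2 * int l + 1))"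
      unfolding eq using odd_half_notin_Ints by blast
    then show "even a"
      by simp
  next
    assume "even a"
    then obtain k where "a = 2 * k"
      by (elim evenE)
    then have "lambda_n l n (signed_pair s i t j a) = of_int (k * (2 * int n - 2 * int l + 1))"
      by (simp add: lambda_n_signed_pair algebra_simps)
    then show "lambda_n l n (signed_pair s i t j a) \<in> \<int>"
      by (simp only: Ints_of_int)
  qed
qed

lemma pos_integral_coroot_cases:
  assumes "\<gamma> \<in> pos_integral_coroots l (lambda_n l n)"
  obtains s i t j a where "\<gamma> = signed_pair s i t j a" "1 \<le> i" "i \<le> j" "j \<le> l"
    "s \<in> {1, -1}" "t \<in> {1, -1}" "i = j \<longrightarrow> s = t" "a > 0 \<or> a = 0 \<and> s = 1" "even a"
proof -
  from assms have "\<gamma> \<in> pos_real_coroots l" and int: "lambda_n l n \<gamma> \<in> \<int>"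
    by (auto simp: pos_integral_coroots_def integral_coroots_def)
  from this(1) show thesis
    by (rule pos_real_coroot_cases) (use int that lambda_n_integral_iff in blast)
qed

lemma pos_integral_sums:
  "pos_integral_coroots l (lambda_n l n) \<subseteq> list_sums (candidates l)"
proof
  fix \<gamma> assume "\<gamma> \<in> pos_integral_coroots l (lambda_n l n)"
  then obtain s i t j a where \<gamma>: "\<gamma> = signed_pair s i t j a" "1 \<le> i" "i \<le> j" "j \<le> l"
    "s \<in> {1, -1}" "t \<in> {1, -1}" "a > 0 \<or> a = 0 \<and> s = 1" "even a"
    by (rule pos_integral_coroot_cases)
  show "\<gamma> \<in> list_sums (candidates l)"
  proof (cases "a = 0")
    case True
    then show ?thesis
      using \<gamma> sum_sums[of i l j] difference_sums[of i j l] by auto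
  next
    case False
    with \<gamma> obtain m where "a = 2 * int (Suc m)"
      by (elim evenE) (metis gr0_implies_Suc mult_eq_0_iff pos_int_cases zero_less_mult_pos
          zero_less_numeral)
    then show ?thesis
      using \<gamma> affine_sums[of i l j s t m] by auto
  qed
qed

lemma candidates_pos_real_roots:
  assumes "l \<ge> 1"
  shows "candidates l \<subseteq> pos_real_coroots l"
proof -
  have "simple_root l i + wscale (of_int 0) delta \<in> pos_real_roots l" if "i \<in> {1..l}" for i
  proof -
    have "simple_root l i \<in> fin_roots l" "simple_root l i \<in> fin_pos_roots l"
      unfolding atomize_conj
    proof (cases "i < l")
      case True
      then have "eps i - eps (i + 1) \<in> fin_roots l" "eps i - eps (i + 1) \<in> fin_pos_roots l"
        unfolding fin_roots_def fin_pos_roots_def using that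
        by (intro UnI2 UN_I[of i] UN_I[of "i + 1"]; simp)+
      then show "simple_root l i \<in> fin_roots l \<and> simple_root l i \<in> fin_pos_roots l"
        using True that by (simp add: simple_root_def)
    next
      case False
      then show "simple_root l i \<in> fin_roots l \<and> simple_root l i \<in> fin_pos_roots l"
        using that by (auto simp: simple_root_def fin_roots_def fin_pos_roots_def)
    qed
    then show ?thesis
      unfolding pos_real_roots_def by blast
  qed
  moreover have "simple_root l i + wscale (of_int 0) delta = simple_root l i" for i
    by (simp add: wscale_def fun_eq_iff)
  moreover have "delta - eps 1 \<in> pos_real_roots l"
  proof -
    have "delta - eps 1 = - eps 1 + wscale (of_int 1) delta"
      by (simp add: wscale_def fun_eq_iff)
    moreover have "- eps 1 \<in> fin_roots l"
      using assms by (auto simp: fin_roots_def)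
    ultimately show ?thesis
      unfolding pos_real_roots_def by (metis (mono_tags, lifting) mem_Collect_eq zero_less_one)
  qed
  ultimately show ?thesis
    by (auto simp: candidates_def pos_real_coroots_def)
qed

lemma candidates_integral:
  assumes "l \<ge> 1"
  shows "candidates l \<subseteq> pos_integral_coroots l (lambda_n l n)"
proof -
  have "lambda_n l n \<gamma> \<in> \<int>" if "\<gamma> \<in> candidates l" for \<gamma>
    using that assms
    by (auto simp: candidates_def coroot_simple_root coroot_delta_minus_eps_1
        lambda_n_integral_iff simp del: One_nat_def)
  moreover have "pos_real_coroots l \<subseteq> real_coroots l"
    by (auto simp: pos_real_coroots_def real_coroots_def pos_real_roots_def real_roots_def)
  ultimately show ?thesis
    using candidates_pos_real_roots[OF assms]
    by (auto simp: pos_integral_coroots_def integral_coroots_def)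
qed

lemma integral_simple_coroots_lambda_n:
  assumes "l \<ge> 1"
  shows "integral_simple_coroots l (lambda_n l n) = candidates l"
  unfolding integral_simple_coroots_def
proof (rule indecomposables_eq_of_height[where height = "height l"])
  show "height l \<gamma> \<ge> 1" if "\<gamma> \<in> pos_integral_coroots l (lambda_n l n)" for \<gamma>
    using that
  proof (rule pos_integral_coroot_cases)
    fix s i t j a
    assume "\<gamma> = signed_pair s i t j a" "1 \<le> i" "i \<le> j" "j \<le> l"
      "s \<in> {1, -1}" "t \<in> {1, -1}" "i = j \<longrightarrow> s = t" "a > 0 \<or> a = 0 \<and> s = 1" "even a"
    then show ?thesis
      using height_ge_1[of i j l s t a "real l"] by (simp add: height_signed_pair)
  qed
qed (use assms in \<open>auto simp: height_zero height_add height_candidates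
      intro: candidates_integral[THEN subsetD] pos_integral_sums[THEN subsetD]\<close>)

section \<open>Rational spans\<close>

interpretation rat: vector_space "\<lambda>q::rat. hscale (of_rat q)"
  by (rule vector_space_rat)

text \<open>
  Solving downwards from \<open>\<alpha>\<^sub>l\<^sup>\<or> = 2 h\<^sub>l\<close> along \<open>\<alpha>\<^sub>i\<^sup>\<or> = h\<^sub>i - h\<^sub>i\<^sub>+\<^sub>1\<close>.
\<close>

lemma h_basis_in_span:
  assumes "(\<lambda>i. coroot l (simple_root l i)) ` {1..l} \<subseteq> rat_span X" and "1 \<le> i" "i \<le> l"
  shows "h_basis i \<in> rat_span X"
  using assms(3,2)
proof (induction i rule: inc_induct)
  case base
  have "h_basis l = hscale (of_rat (1 / 2)) (coroot l (simple_root l l))"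
    using base by (auto simp: coroot_simple_root signed_pair_eq h_basis_def hscale_def fun_eq_iff
        of_rat_divide)
  moreover have "coroot l (simple_root l l) \<in> rat_span X"
    using assms(1) base by auto
  ultimately show ?case
    unfolding rat_span_def by (metis rat.span_scale)
next
  case (step i)
  have "h_basis i = coroot l (simple_root l i) + h_basis (Suc i)"
    using step by (auto simp: coroot_simple_root signed_pair_eq h_basis_def fun_eq_iff)
  moreover have "coroot l (simple_root l i) \<in> rat_span X"
    using assms(1) step by auto
  ultimately show ?case
    using step unfolding rat_span_def by (auto intro: rat.span_add)
qed

lemma signed_pair_in_span:
  assumes "h_basis i \<in> rat_span X" "h_basis j \<in> rat_span X" "c_elt \<in> rat_span X"
  shows "signed_pair s i t j a \<in> rat_span X"
proof -
  have "signed_pair s i t j a = hscale (of_rat (of_int s)) (h_basis i)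
      + hscale (of_rat (of_int t)) (h_basis j) + hscale (of_rat (of_int a)) c_elt"
    by (simp add: signed_pair_def)
  also have "\<dots> \<in> rat_span X"
    using assms unfolding rat_span_def by (intro rat.span_add rat.span_scale)
  finally show ?thesis .
qed

lemma real_coroots_in_span:
  assumes "\<And>i. 1 \<le> i \<Longrightarrow> i \<le> l \<Longrightarrow> h_basis i \<in> rat_span X" "c_elt \<in> rat_span X"
  shows "real_coroots l \<subseteq> rat_span X"
proof
  fix \<gamma> assume "\<gamma> \<in> real_coroots l"
  then obtain \<alpha> m where \<gamma>: "\<gamma> = coroot l (\<alpha> + wscale (of_int m) delta)" and "\<alpha> \<in> fin_roots l"
    by (auto simp: real_coroots_def real_roots_def)
  from this(2) show "\<gamma> \<in> rat_span X"
    by (rule coroot_fin_root) (auto simp: \<gamma> intro!: signed_pair_in_span assms)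
qed

lemma rat_span_eqI:
  assumes "A \<subseteq> rat_span B" "B \<subseteq> rat_span A"
  shows "rat_span A = rat_span B"
  using assms unfolding rat_span_def by (simp add: rat.span_eq)

text \<open>
  Both spans contain all \<open>h\<^sub>i\<close> and \<open>c\<close>, hence all real coroots: \<open>c\<close> is
  \<open>\<alpha>\<^sub>0\<^sup>\<or> + h\<^sub>1 + h\<^sub>2\<close> on the one side and half of \<open>(\<delta> - \<epsilon>\<^sub>1)\<^sup>\<or>\<close> plus \<open>h\<^sub>1\<close> on the other.
\<close>

lemma rat_span_integral_coroots:
  assumes "l \<ge> 2"
  shows "rat_span (integral_coroots l (lambda_n l n)) = rat_span (simple_coroots l)"
proof (rule rat_span_eqI)
  define X where "X = simple_coroots l"
  have base: "coroot l (simple_root l i) \<in> rat_span X" if "i \<le> l" for i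
    using that unfolding X_def rat_span_def
    by (intro rat.span_base) (auto simp: simple_coroots_def)
  then have h: "h_basis i \<in> rat_span X" if "1 \<le> i" "i \<le> l" for i
    using that by (intro h_basis_in_span) auto
  have "c_elt = coroot l (simple_root l 0) + h_basis 1 + h_basis 2"
    using assms
    by (auto simp: coroot_simple_root_0 signed_pair_eq h_basis_def c_elt_def fun_eq_iff)
  moreover have "coroot l (simple_root l 0) + h_basis 1 + h_basis 2 \<in> rat_span X"
    using base[of 0] h[of 1] h[of 2] assms unfolding rat_span_def by (auto intro!: rat.span_add)
  ultimately have "real_coroots l \<subseteq> rat_span X"
    using h by (intro real_coroots_in_span) auto
  then show "integral_coroots l (lambda_n l n) \<subseteq> rat_span (simple_coroots l)"
    by (auto simp: integral_coroots_def X_def)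
next
  define X where "X = integral_coroots l (lambda_n l n)"
  have cand: "candidates l \<subseteq> rat_span X"
    using candidates_integral[of l n] assms rat.span_superset[of X]
    by (auto simp: X_def rat_span_def pos_integral_coroots_def)
  then have h: "h_basis i \<in> rat_span X" if "1 \<le> i" "i \<le> l" for i
    using that by (intro h_basis_in_span) (auto simp: candidates_def)
  have "c_elt = hscale (of_rat (1 / 2)) (coroot l (delta - eps 1)) + h_basis 1"
    using assms
    by (auto simp: coroot_delta_minus_eps_1 signed_pair_eq h_basis_def c_elt_def hscale_def
        fun_eq_iff of_rat_divide simp del: One_nat_def)
  moreover have "hscale (of_rat (1 / 2)) (coroot l (delta - eps 1)) + h_basis 1 \<in> rat_span X"
    using cand h[of 1] assms unfolding rat_span_def
    by (intro rat.span_add rat.span_scale) (auto simp: candidates_def)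
  ultimately have c: "c_elt \<in> rat_span X"
    by simp
  have "coroot l (simple_root l i) \<in> rat_span X" if "i \<le> l" for i
  proof (cases "i = 0")
    case True
    have "signed_pair (-1) 1 (-1) 2 1 \<in> rat_span X"
      using h c assms by (intro signed_pair_in_span) auto
    then show ?thesis
      using True coroot_simple_root_0[OF assms] by simp
  next
    case False
    then show ?thesis
      using that cand by (auto simp: candidates_def)
  qed
  then show "simple_coroots l \<subseteq> rat_span (integral_coroots l (lambda_n l n))"
    by (auto simp: simple_coroots_def X_def)
qed

section \<open>The shifted weight\<close>

lemma dual_signed_pair:
  assumes "f \<in> cartan_dual l" "i \<in> {1..l}" "j \<in> {1..l}"
  shows "f (signed_pair s i t j a) =
    of_int s * f (h_basis i) + of_int t * f (h_basis j) + of_int a * f c_elt"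
proof -
  have basis: "h_basis i \<in> cartan l" "h_basis j \<in> cartan l" "c_elt \<in> cartan l"
    using assms(2,3) by (auto simp: cartan_def h_basis_def c_elt_def)
  have scale: "hscale z x \<in> cartan l" "f (hscale z x) = z * f x" if "x \<in> cartan l" for z x
    using that assms(1) by (auto simp: cartan_def hscale_def cartan_dual_def)
  have add: "x + y \<in> cartan l" "f (x + y) = f x + f y" if "x \<in> cartan l" "y \<in> cartan l" for x y
    using that assms(1) by (auto simp: cartan_def cartan_dual_def)
  show ?thesis
    by (simp add: signed_pair_def add scale basis)
qed

lemma rho_simple:
  assumes "is_rho l \<rho>" "i \<le> l"
  shows "\<rho> (coroot l (simple_root l i)) = 1"
  using assms by (auto simp: is_rho_def)

lemma rho_signed_pair:
  assumes "is_rho l \<rho>" "i \<in> {1..l}" "j \<in> {1..l}"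
  shows "\<rho> (signed_pair s i t j a) =
    of_int s * \<rho> (h_basis i) + of_int t * \<rho> (h_basis j) + of_int a * \<rho> c_elt"
  using assms dual_signed_pair by (auto simp: is_rho_def)

lemma rho_h_basis:
  assumes "is_rho l \<rho>" "1 \<le> i" "i \<le> l"
  shows "\<rho> (h_basis i) = of_nat l - of_nat i + 1 / 2"
  using assms(3,2)
proof (induction i rule: inc_induct)
  case base
  have "\<rho> (signed_pair 1 l 1 l 0) = 1"
    using rho_simple[OF assms(1), of l] base by (simp add: coroot_simple_root)
  then have "2 * \<rho> (h_basis l) = 1"
    using base assms(1) by (simp add: rho_signed_pair[OF assms(1)])
  then show ?case
    by (simp add: field_simps)
next
  case (step i)
  have "\<rho> (signed_pair 1 i (-1) (Suc i) 0) = 1"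
    using rho_simple[OF assms(1), of i] step by (simp add: coroot_simple_root)
  then have "\<rho> (h_basis i) - \<rho> (h_basis (Suc i)) = 1"
    using step.hyps step.prems by (simp add: rho_signed_pair[OF assms(1)])
  then have "\<rho> (h_basis i) = 1 + \<rho> (h_basis (Suc i))"
    by (simp add: algebra_simps)
  then show ?case
    using step by simp
qed

text \<open>The value on \<open>c\<close> is the dual Coxeter number of type \<open>B\<^sub>l\<close>.\<close>

lemma rho_c_elt:
  assumes "is_rho l \<rho>" "l \<ge> 2"
  shows "\<rho> c_elt = 2 * of_nat l - 1"
proof -
  have "\<rho> (signed_pair (-1) 1 (-1) 2 1) = 1"
    using rho_simple[OF assms(1), of 0] assms(2) by (simp add: coroot_simple_root_0)
  then have "- \<rho> (h_basis 1) - \<rho> (h_basis 2) + \<rho> c_elt = 1"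
    using assms by (simp add: rho_signed_pair[OF assms(1)])
  then have "\<rho> c_elt = 1 + \<rho> (h_basis 1) + \<rho> (h_basis 2)"
    by (simp add: algebra_simps)
  also have "\<dots> = 2 * of_nat l - 1"
    using assms(2) by (simp add: rho_h_basis[OF assms(1)])
  finally show ?thesis .
qed

lemma shifted_signed_pair:
  assumes "is_rho l \<rho>" "l \<ge> 2" "i \<in> {1..l}" "j \<in> {1..l}"
  shows "(lambda_n l n + \<rho>) (signed_pair s i t j a) = of_real
    (of_int s * (real l - real i + 1 / 2) + of_int t * (real l - real j + 1 / 2)
      + of_int a * (real n + real l - 1 / 2))"
proof -
  have "\<rho> (signed_pair s i t j a) = of_int s * (of_nat l - of_nat i + 1 / 2)
      + of_int t * (of_nat l - of_nat j + 1 / 2) + of_int a * (2 * of_nat l - 1)"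
    using assms by (simp add: rho_signed_pair[OF assms(1)] rho_h_basis rho_c_elt)
  then show ?thesis
    by (simp add: lambda_n_signed_pair algebra_simps)
qed

lemma shifted_not_nonpos_Int:
  assumes "is_rho l \<rho>" "l \<ge> 2" "n \<ge> 1" "\<gamma> \<in> pos_real_coroots l"
  shows "(lambda_n l n + \<rho>) \<gamma> \<notin> \<int>\<^sub>\<le>\<^sub>0"
  using assms(4)
proof (rule pos_real_coroot_cases)
  fix s i t j a
  assume \<gamma>: "\<gamma> = signed_pair s i t j a" "1 \<le> i" "i \<le> j" "j \<le> l"
    "s \<in> {1, -1}" "t \<in> {1, -1}" "i = j \<longrightarrow> s = t \<and> even a" "a > 0 \<or> a = 0 \<and> s = 1"
  define v where "v = of_int s * (real l - real i + 1 / 2) + of_int t * (real l - real j + 1 / 2)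
      + of_int a * (real n + real l - 1 / 2)"
  have v: "(lambda_n l n + \<rho>) \<gamma> = of_real v"
    using shifted_signed_pair[OF assms(1,2)] \<gamma> unfolding v_def by auto
  show ?thesis
  proof (cases "even a")
    case True
    have "v \<ge> 1"
      unfolding v_def using assms(3) True \<gamma> by (intro height_ge_1) auto
    then show ?thesis
      unfolding v by (auto elim!: nonpos_Ints_cases simp: complex_eq_iff)
  next
    case False
    \<comment> \<open>Twice the value: a sum of three odd integers.\<close>
    define k where "k = s * (2 * (int l - int i) + 1) + t * (2 * (int l - int j) + 1)
        + a * (2 * (int n + int l) - 1)"
    have "odd k"
      using False \<gamma>(5,6) unfolding k_def by auto
    moreover have "of_real v = (of_int k / 2 :: complex)"
      unfolding v_def k_def by (simp add: field_simps)
    ultimately have "of_real v \<notin> (\<int> :: complex set)"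
      using odd_half_notin_Ints by metis
    then show ?thesis
      unfolding v using nonpos_Ints_subset_Ints by blast
  qed
qed

lemma lambda_n_cartan_dual: "lambda_n l n \<in> cartan_dual l"
  by (auto simp: cartan_dual_def lambda_n_def wscale_def Lambda0_def hscale_def algebra_simps)

theorem lemma3p1:
  fixes l n :: nat and \<rho> :: weight
  assumes "l \<ge> 2" and "n \<ge> 1" and "is_rho l \<rho>"
  shows "admissible l \<rho> (lambda_n l n) \<and>
    integral_simple_coroots l (lambda_n l n) =
      insert (coroot l (delta - eps 1)) ((\<lambda>i. coroot l (simple_root l i)) ` {1..l}) \<and>
    (\<forall>i\<in>{1..l}. (lambda_n l n + \<rho>) (coroot l (simple_root l i)) = 1) \<and>
    (lambda_n l n + \<rho>) (coroot l (delta - eps 1)) = 2 * of_nat n"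
proof (intro conjI ballI)
  show "admissible l \<rho> (lambda_n l n)"
    using assms lambda_n_cartan_dual shifted_not_nonpos_Int rat_span_integral_coroots
    by (auto simp: admissible_def)
  show "integral_simple_coroots l (lambda_n l n) =
      insert (coroot l (delta - eps 1)) ((\<lambda>i. coroot l (simple_root l i)) ` {1..l})"
    using integral_simple_coroots_lambda_n[of l n] assms by (simp add: candidates_def)
  show "(lambda_n l n + \<rho>) (coroot l (simple_root l i)) = 1" if "i \<in> {1..l}" for i
  proof -
    have "lambda_n l n (coroot l (simple_root l i)) = 0"
      using that by (simp add: coroot_simple_root lambda_n_signed_pair)
    then show ?thesis
      using rho_simple[OF assms(3), of i] that by simp
  qed
  show "(lambda_n l n + \<rho>) (coroot l (delta - eps 1)) = 2 * of_nat n"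
    using assms
    by (simp add: coroot_delta_minus_eps_1 shifted_signed_pair del: plus_fun_apply One_nat_def)
qed

end
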